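(* Let $p$ be an odd prime with $p \equiv 3 \pmod 4$, let $m \geq 0$ be an integer, and let $t \in \mathbb{Z}_p$. Then $$ N_{2m+1}(t, p) = \begin{cases} p^{2m} & \text{if } t = 0, \\ p^{2m} + (-1)^{m+1} p^m & \text{if } t \text{ is a non-residue} \pmod p, \\ p^{2m} + (-1)^{m} p^m & \text{if } t \text{ is a residue} \pmod p. \end{cases} $$
   Context: $\mathbb{Z}_p$ denotes the ring of integers modulo $p$. For $t \in \mathbb{Z}_p$, $N_j(t,p)$ is the number of ordered $j$-tuples $(x_1,\dots,x_j) \in \mathbb{Z}_p^j$ with $\sum_{i=1}^j x_i^2 = t$ in $\mathbb{Z}_p$ (zero entries are allowed). "Residue" means a nonzero square in $\mathbb{Z}_p$ and "non-residue" means an element of $\mathbb{Z}_p$ that is not a square. *)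

theory Defs
  imports "HOL-Number_Theory.Residues"
begin

text \<open>The ring of integers modulo \<open>p\<close> is the library's \<open>residue_ring (int p)\<close>, whose carrier
  consists of the representatives \<open>0, \<dots>, p - 1\<close>. The \<open>j\<close>-tuples are the extensional functions
  on \<open>{1..j}\<close>, so that each tuple is represented by exactly one function.\<close>

definition num_sum_squares :: "nat \<Rightarrow> int \<Rightarrow> nat \<Rightarrow> nat" where
  "num_sum_squares j t p =
    card {x \<in> {1..j} \<rightarrow>\<^sub>E carrier (residue_ring (int p)).
      (\<Oplus>\<^bsub>residue_ring (int p)\<^esub>i\<in>{1..j}. x i [^]\<^bsub>residue_ring (int p)\<^esub> (2::nat)) = t}"

definition is_square_mod :: "nat \<Rightarrow> int \<Rightarrow> bool" where
  "is_square_mod p t \<longleftrightarrow>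
    (\<exists>y\<in>carrier (residue_ring (int p)). t = y [^]\<^bsub>residue_ring (int p)\<^esub> (2::nat))"

definition is_residue :: "nat \<Rightarrow> int \<Rightarrow> bool" where
  "is_residue p t \<longleftrightarrow> t \<noteq> \<zero>\<^bsub>residue_ring (int p)\<^esub> \<and> is_square_mod p t"

definition is_nonresidue :: "nat \<Rightarrow> int \<Rightarrow> bool" where
  "is_nonresidue p t \<longleftrightarrow> t \<in> carrier (residue_ring (int p)) \<and> \<not> is_square_mod p t"

end

theory Submission
  imports Defs "HOL-Number_Theory.Euler_Criterion"
begin

text \<open>
  Everything is driven by the two-variable count: for \<open>p \<equiv> 3 (mod 4)\<close> the congruence
  \<open>x\<^sup>2 + y\<^sup>2 \<equiv> s\<close> has one solution if \<open>s \<equiv> 0\<close> and \<open>p + 1\<close> solutions otherwise. There is only the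
  trivial solution for \<open>s \<equiv> 0\<close> because \<open>-1\<close> is not a square. For the other \<open>s\<close>, the Brahmagupta
  identity \<open>(a\<^sup>2 + b\<^sup>2) (x\<^sup>2 + y\<^sup>2) = (a x - b y)\<^sup>2 + (a y + b x)\<^sup>2\<close> (multiplicativity of the norm of
  \<open>\<int>[i]\<close>) makes multiplication by \<open>a + b i\<close> an injection from the solutions for \<open>s\<close> into those for
  \<open>(a\<^sup>2 + b\<^sup>2) s\<close>. Since every residue class is a sum of two squares
  (\<open>sum_two_squares_mod_prime\<close>), all nonzero \<open>s\<close> have the same number of solutions
  (\<open>two_squares_count_eq\<close>), and these \<open>p - 1\<close> equal numbers together with the one trivial solution
  exhaust the \<open>p\<^sup>2\<close> pairs.

  Splitting off two variables now gives, since the counts \<open>N\<^sub>j(t)\<close> over all \<open>t\<close> add up to \<open>p\<^sup>j\<close>,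
  the recursion \<open>N\<^sub>j\<^sub>+\<^sub>2(t) = (p + 1) p\<^sup>j - p N\<^sub>j(t)\<close> (\<open>squares_count_add_2\<close>). In terms of
  the deviation from the mean value it says that \<open>N\<^sub>j\<^sub>+\<^sub>2(t) - p\<^sup>j\<^sup>+\<^sup>1\<close> is \<open>-p\<close> times
  \<open>N\<^sub>j(t) - p\<^sup>j\<^sup>-\<^sup>1\<close>. Hence \<open>N\<^sub>2\<^sub>m\<^sub>+\<^sub>1(t) = p\<^sup>2\<^sup>m + (-p)\<^sup>m (N\<^sub>1(t) - 1)\<close>, and \<open>N\<^sub>1(t)\<close> is \<open>1\<close>, \<open>0\<close> or \<open>2\<close>
  for \<open>t\<close> zero, a non-residue or a residue.
\<close>

section \<open>Counting solutions by congruences of integers\<close>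

text \<open>
  The variables run through representatives, but the target \<open>t\<close> may be any integer and matters only
  modulo \<open>p\<close>, so that recursions may subtract squares from it.
\<close>

definition squares_count :: "nat \<Rightarrow> nat \<Rightarrow> int \<Rightarrow> nat" where
  "squares_count p j t =
    card {x \<in> {1..j} \<rightarrow>\<^sub>E {0..<int p}. [(\<Sum>i\<in>{1..j}. (x i)\<^sup>2) = t] (mod int p)}"

definition two_squares_count :: "nat \<Rightarrow> int \<Rightarrow> nat" where
  "two_squares_count p s =
    card {(x, y) \<in> {0..<int p} \<times> {0..<int p}. [x\<^sup>2 + y\<^sup>2 = s] (mod int p)}"

lemma num_sum_squares_eq_squares_count:
  assumes "p > 1" "t \<in> {0..<int p}"
  shows "num_sum_squares j t p = squares_count p j t"
proof -
  interpret residues "int p" "residue_ring (int p)"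
    using assms(1) by unfold_locales auto
  have carr: "carrier (residue_ring (int p)) = {0..<int p}"
    by (auto simp: res_carrier_eq)
  have pow: "a [^]\<^bsub>residue_ring (int p)\<^esub> (2::nat) = a\<^sup>2 mod int p" if "a \<in> {0..<int p}" for a
    using pow_cong[of a 2] that by simp
  have "(\<Oplus>\<^bsub>residue_ring (int p)\<^esub>i\<in>{1..j}. x i [^]\<^bsub>residue_ring (int p)\<^esub> (2::nat))
      = (\<Sum>i\<in>{1..j}. (x i)\<^sup>2) mod int p" if x: "x \<in> {1..j} \<rightarrow>\<^sub>E {0..<int p}" for x
  proof -
    have "(\<Oplus>\<^bsub>residue_ring (int p)\<^esub>i\<in>{1..j}. x i [^]\<^bsub>residue_ring (int p)\<^esub> (2::nat))
      = (\<Oplus>\<^bsub>residue_ring (int p)\<^esub>i\<in>{1..j}. (x i)\<^sup>2 mod int p)"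
      by (rule finsum_cong') (use x pow PiE_mem[OF x] mod_in_carrier in auto)
    then show ?thesis by (simp add: sum_cong)
  qed
  moreover have "t mod int p = t" using assms(2) by simp
  ultimately show ?thesis
    unfolding num_sum_squares_def squares_count_def carr cong_def
    by (intro arg_cong[where f = card]) auto
qed

lemma is_square_mod_iff_QuadRes:
  assumes "p > 1" "t \<in> {0..<int p}"
  shows "is_square_mod p t \<longleftrightarrow> QuadRes (int p) t"
proof -
  interpret residues "int p" "residue_ring (int p)"
    using assms(1) by unfold_locales auto
  have carr: "carrier (residue_ring (int p)) = {0..<int p}"
    by (auto simp: res_carrier_eq)
  have pow: "a [^]\<^bsub>residue_ring (int p)\<^esub> (2::nat) = a\<^sup>2 mod int p" if "a \<in> {0..<int p}" for a
    using pow_cong[of a 2] that by simp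
  have tm: "t mod int p = t" using assms(2) by simp
  show ?thesis
  proof
    assume "is_square_mod p t"
    then obtain y where "y \<in> {0..<int p}" "t = y\<^sup>2 mod int p"
      unfolding is_square_mod_def carr using pow by blast
    then show "QuadRes (int p) t" unfolding QuadRes_def cong_def by auto
  next
    assume "QuadRes (int p) t"
    then obtain y where y: "y\<^sup>2 mod int p = t" unfolding QuadRes_def cong_def tm by auto
    have mem: "y mod int p \<in> {0..<int p}" using assms(1) by simp
    have "(y mod int p) [^]\<^bsub>residue_ring (int p)\<^esub> (2::nat) = t"
      using pow[OF mem] y by (simp add: power_mod)
    then show "is_square_mod p t" unfolding is_square_mod_def carr using mem by auto
  qed
qed

lemma squares_count_cong:
  assumes "[s = t] (mod int p)"
  shows "squares_count p j s = squares_count p j t"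
  using assms unfolding squares_count_def cong_def by simp

lemma squares_count_Suc:
  "squares_count p (Suc j) t = (\<Sum>y\<in>{0..<int p}. squares_count p j (t - y\<^sup>2))"
proof -
  let ?C = "{0..<int p}"
  let ?P = "{1..j} \<rightarrow>\<^sub>E ?C"
  let ?S = "SIGMA y:?C. {x \<in> ?P. [(\<Sum>i\<in>{1..j}. (x i)\<^sup>2) = t - y\<^sup>2] (mod int p)}"
  let ?f = "\<lambda>(y, g). g(Suc j := y)"
  have ins: "{1..Suc j} = insert (Suc j) {1..j}" by auto
  have PiE: "({1..Suc j} \<rightarrow>\<^sub>E ?C) = ?f ` (?C \<times> ?P)"
    unfolding ins by (rule PiE_insert_eq)
  have sum: "[(\<Sum>i\<in>{1..Suc j}. ((g(Suc j := y)) i)\<^sup>2) = t] (mod int p) \<longleftrightarrow>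
      [(\<Sum>i\<in>{1..j}. (g i)\<^sup>2) = t - y\<^sup>2] (mod int p)" for g :: "nat \<Rightarrow> int" and y
  proof -
    have "(\<Sum>i\<in>{1..Suc j}. ((g(Suc j := y)) i)\<^sup>2) = y\<^sup>2 + (\<Sum>i\<in>{1..j}. (g i)\<^sup>2)"
      unfolding ins by (subst sum.insert) (auto intro!: sum.cong)
    then show ?thesis by (simp add: cong_iff_dvd_diff algebra_simps)
  qed
  have "{x \<in> {1..Suc j} \<rightarrow>\<^sub>E ?C. [(\<Sum>i\<in>{1..Suc j}. (x i)\<^sup>2) = t] (mod int p)} = ?f ` ?S"
    unfolding PiE using sum by fast
  moreover have "inj_on ?f ?S"
    by (rule inj_on_subset[OF inj_combinator[of "Suc j" "{1..j}" "\<lambda>_. ?C"]]) auto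
  moreover have "finite ?P" by (intro finite_PiE) auto
  ultimately show ?thesis
    unfolding squares_count_def by (simp add: card_image)
qed

lemma squares_count_1:
  "squares_count p 1 t = card {y \<in> {0..<int p}. [y\<^sup>2 = t] (mod int p)}"
proof -
  have "squares_count p 0 u = (if [0 = u] (mod int p) then 1 else 0)" for u
    by (auto simp: squares_count_def)
  then have "squares_count p (Suc 0) t = (\<Sum>y\<in>{0..<int p}. if [y\<^sup>2 = t] (mod int p) then 1 else 0)"
    unfolding squares_count_Suc by (intro sum.cong) (auto simp: cong_iff_dvd_diff dvd_diff_commute[of "int p" t])
  then show ?thesis by (simp add: sum.If_cases Int_def)
qed

text \<open>Every tuple is counted for exactly one \<open>s\<close>, the residue of \<open>t\<close> minus its sum of squares.\<close>

lemma sum_squares_count: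
  assumes "p > 0"
  shows "(\<Sum>s\<in>{0..<int p}. squares_count p j (t - s)) = p ^ j"
proof -
  let ?P = "{1..j} \<rightarrow>\<^sub>E {0..<int p}"
  have fin: "finite ?P" by (intro finite_PiE) auto
  have eq: "squares_count p j (t - s) =
      card {x \<in> ?P. (t - (\<Sum>i\<in>{1..j}. (x i)\<^sup>2)) mod int p = s}" if s: "s \<in> {0..<int p}" for s
  proof -
    have "[a = t - s] (mod int p) \<longleftrightarrow> (t - a) mod int p = s" for a
    proof -
      have "[a = t - s] (mod int p) \<longleftrightarrow> [t - a = s] (mod int p)"
        unfolding cong_iff_dvd_diff by (subst dvd_minus_iff[symmetric]) (simp add: algebra_simps)
      then show ?thesis using s by (simp add: cong_def)
    qed
    then show ?thesis unfolding squares_count_def by simp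
  qed
  have "card ?P = (\<Sum>s\<in>{0..<int p}. squares_count p j (t - s))"
    using sum_fun_comp[OF fin, of "{0..<int p}" "\<lambda>x. (t - (\<Sum>i\<in>{1..j}. (x i)\<^sup>2)) mod int p" "\<lambda>_. 1::nat"]
      assms eq by (auto simp: image_subset_iff)
  then show ?thesis by (simp add: card_PiE)
qed

section \<open>Sums of two squares modulo a prime\<close>

text \<open>
  By Euler's criterion both factors have \<open>(p - 1) / 2\<close>-th power \<open>-1\<close>, so their product has power \<open>1\<close>.
\<close>

lemma QuadRes_mult_nonresidues:
  fixes a b :: int
  assumes "prime p" "2 < p" "\<not> QuadRes (int p) a" "\<not> QuadRes (int p) b"
  shows "QuadRes (int p) (a * b)"
proof -
  have nz: "\<not> [c = 0] (mod int p)" if "\<not> QuadRes (int p) c" for c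
  proof
    assume "[c = 0] (mod int p)"
    then have "[0\<^sup>2 = c] (mod int p)" by (simp add: cong_sym)
    then show False using that unfolding QuadRes_def by blast
  qed
  let ?e = "(p - 1) div 2"
  have "[-1 = a ^ ?e] (mod int p)" "[-1 = b ^ ?e] (mod int p)"
    using euler_criterion[OF assms(1,2), of a] euler_criterion[OF assms(1,2), of b]
      assms(3,4) nz by (auto simp: Legendre_def)
  then have "[(-1) * (-1) = (a * b) ^ ?e] (mod int p)"
    unfolding power_mult_distrib by (rule cong_mult)
  then have "[Legendre (a * b) (int p) = 1] (mod int p)"
    using euler_criterion[OF assms(1,2), of "a * b"] by (metis cong_sym cong_trans mult_minus1 minus_minus)
  moreover have "\<not> [0 = 1] (mod int p)" "\<not> [-1 = 1] (mod int p)"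
    using assms(2) zdvd_imp_le[of "int p" 2] by (auto simp: cong_iff_dvd_diff)
  ultimately show ?thesis unfolding Legendre_def by (auto split: if_splits)
qed

text \<open>
  The least non-residue \<open>n\<close> satisfies \<open>n = (n - 1) + 1\<close>, where \<open>n - 1\<close> is a square, so it is a sum of
  two squares; every other non-residue differs from \<open>n\<close> by a square factor.
\<close>

lemma sum_two_squares_mod_prime:
  fixes s :: int
  assumes "prime p" "2 < p"
  obtains a b where "[a\<^sup>2 + b\<^sup>2 = s] (mod int p)"
proof (cases "QuadRes (int p) s")
  case True
  then obtain a where "[a\<^sup>2 + 0\<^sup>2 = s] (mod int p)" unfolding QuadRes_def by auto
  then show ?thesis by (rule that)
next
  case False
  let ?Q = "\<lambda>n::nat. \<not> QuadRes (int p) (int n)"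
  have "[s = int (nat (s mod int p))] (mod int p)" using assms by (simp add: cong_def)
  then have ex: "?Q (nat (s mod int p))" using False unfolding QuadRes_def by (metis cong_sym cong_trans)
  define n where "n = (LEAST n. ?Q n)"
  have n: "?Q n" and least: "\<And>k. k < n \<Longrightarrow> \<not> ?Q k"
    using LeastI[of ?Q, OF ex] not_less_Least[of _ ?Q] unfolding n_def by auto
  have "QuadRes (int p) 0" unfolding QuadRes_def by (rule exI[of _ 0]) simp
  then have "n \<noteq> 0" using n by (metis of_nat_0)
  then have "\<not> ?Q (n - 1)" by (intro least) simp
  then obtain c where c: "[c\<^sup>2 = int (n - 1)] (mod int p)" unfolding QuadRes_def by auto
  have c1: "[c\<^sup>2 + 1 = int n] (mod int p)"
    using cong_add[OF c cong_refl[of 1]] \<open>n \<noteq> 0\<close> by (simp add: of_nat_diff)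
  obtain y where y: "[y\<^sup>2 = int n * s] (mod int p)"
    using QuadRes_mult_nonresidues[OF assms n False] unfolding QuadRes_def by auto
  have "\<not> int p dvd int n"
  proof
    assume "int p dvd int n"
    then have "[0\<^sup>2 = int n] (mod int p)" by (simp add: cong_0_iff cong_sym_eq[of 0])
    then show False using n unfolding QuadRes_def by blast
  qed
  then have "coprime (int n) (int p)" 
    using assms(1) by (metis prime_imp_coprime coprime_commute prime_nat_int_transfer)
  then obtain v where v: "[int n * v = 1] (mod int p)" using cong_solve_coprime_int by blast
  \<comment> \<open>Modulo \<open>p\<close> the witnesses are \<open>c y / n\<close> and \<open>y / n\<close>, and \<open>(c\<^sup>2 + 1) y\<^sup>2 / n\<^sup>2 = y\<^sup>2 / n = s\<close>.\<close>
  have "[(c\<^sup>2 + 1) * (y\<^sup>2 * v\<^sup>2) = int n * ((int n * s) * v\<^sup>2)] (mod int p)"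
    by (intro cong_mult c1 y cong_refl)
  also have "int n * ((int n * s) * v\<^sup>2) = (int n * v)\<^sup>2 * s"
    by (simp add: power2_eq_square algebra_simps)
  also have "[(int n * v)\<^sup>2 * s = 1\<^sup>2 * s] (mod int p)"
    by (intro cong_mult cong_pow v cong_refl)
  finally have "[(c * y * v)\<^sup>2 + (y * v)\<^sup>2 = s] (mod int p)"
    by (simp add: power2_eq_square algebra_simps)
  then show ?thesis by (rule that)
qed

text \<open>
  Multiplication by \<open>a + b i\<close> with \<open>a\<^sup>2 + b\<^sup>2 \<equiv> c\<close> is injective modulo \<open>p\<close>, because multiplication by
  the conjugate \<open>a - b i\<close> undoes it up to the unit \<open>c\<close>.
\<close>

lemma two_squares_count_le_mult:
  assumes p: "prime p" "2 < p" and c: "\<not> [c = 0] (mod int p)"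
  shows "two_squares_count p s \<le> two_squares_count p (c * s)"
proof -
  obtain a b where ab: "[a\<^sup>2 + b\<^sup>2 = c] (mod int p)"
    using sum_two_squares_mod_prime[OF p] .
  let ?C = "{0..<int p}"
  let ?S = "\<lambda>s. {(x, y) \<in> ?C \<times> ?C. [x\<^sup>2 + y\<^sup>2 = s] (mod int p)}"
  let ?f = "\<lambda>(x, y). ((a * x - b * y) mod int p, (a * y + b * x) mod int p)"
  have fin: "finite (?S (c * s))" by (rule finite_subset[of _ "?C \<times> ?C"]) auto
  have norm_dvd: "\<not> int p dvd a\<^sup>2 + b\<^sup>2"
    using ab c by (metis cong_0_iff cong_dvd_iff)
  have cancel: "u = v" if "u \<in> ?C" "v \<in> ?C" "int p dvd (a\<^sup>2 + b\<^sup>2) * (u - v)" for u v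
  proof -
    have "int p dvd u - v"
      using that(3) norm_dvd p(1) prime_dvd_mult_iff[of "int p"] by auto
    then have "[u = v] (mod int p)" by (simp add: cong_iff_dvd_diff)
    then show ?thesis using that by (simp add: cong_def)
  qed
  have "inj_on ?f (?S s)"
  proof (rule inj_onI, clarify)
    fix x y x' y'
    assume mem: "x \<in> ?C" "y \<in> ?C" "x' \<in> ?C" "y' \<in> ?C"
      and 1: "(a * x - b * y) mod int p = (a * x' - b * y') mod int p"
      and 2: "(a * y + b * x) mod int p = (a * y' + b * x') mod int p"
    let ?d = "(a * x - b * y) - (a * x' - b * y')" and ?e = "(a * y + b * x) - (a * y' + b * x')"
    have d: "int p dvd ?d" "int p dvd ?e" using 1 2 by (simp_all add: mod_eq_dvd_iff)
    have "(a\<^sup>2 + b\<^sup>2) * (x - x') = a * ?d + b * ?e" "(a\<^sup>2 + b\<^sup>2) * (y - y') = a * ?e - b * ?d"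
      by (simp_all add: power2_eq_square algebra_simps)
    then have "int p dvd (a\<^sup>2 + b\<^sup>2) * (x - x')" "int p dvd (a\<^sup>2 + b\<^sup>2) * (y - y')"
      using d by (simp_all only: dvd_add dvd_diff dvd_mult)
    then show "x = x' \<and> y = y'" using cancel mem by blast
  qed
  moreover have "?f ` ?S s \<subseteq> ?S (c * s)"
  proof -
    have "[((a * x - b * y) mod int p)\<^sup>2 + ((a * y + b * x) mod int p)\<^sup>2 = c * s] (mod int p)"
      if "[x\<^sup>2 + y\<^sup>2 = s] (mod int p)" for x y
    proof -
      have "[((a * x - b * y) mod int p)\<^sup>2 + ((a * y + b * x) mod int p)\<^sup>2
          = (a * x - b * y)\<^sup>2 + (a * y + b * x)\<^sup>2] (mod int p)"
        by (intro cong_add cong_pow) (simp_all add: cong_def)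
      also have "(a * x - b * y)\<^sup>2 + (a * y + b * x)\<^sup>2 = (a\<^sup>2 + b\<^sup>2) * (x\<^sup>2 + y\<^sup>2)"
        by (simp add: power2_eq_square algebra_simps)
      also have "[\<dots> = c * s] (mod int p)" by (rule cong_mult[OF ab that])
      finally show ?thesis .
    qed
    then show ?thesis using p(2) by auto
  qed
  ultimately show ?thesis
    unfolding two_squares_count_def using card_inj_on_le[OF _ _ fin] by blast
qed

lemma two_squares_count_cong:
  assumes "[s = t] (mod int p)"
  shows "two_squares_count p s = two_squares_count p t"
  using assms unfolding two_squares_count_def cong_def by simp

lemma two_squares_count_eq:
  assumes p: "prime p" "2 < p" and s: "\<not> [s = 0] (mod int p)"
  shows "two_squares_count p s = two_squares_count p 1"
proof (rule antisym)
  show "two_squares_count p 1 \<le> two_squares_count p s"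
    using two_squares_count_le_mult[OF p s, of 1] by simp
  have "coprime s (int p)"
    using s p(1) by (metis cong_0_iff prime_imp_coprime coprime_commute prime_nat_int_transfer)
  then obtain v where v: "[s * v = 1] (mod int p)" using cong_solve_coprime_int by blast
  have "\<not> [v = 0] (mod int p)"
  proof
    assume "[v = 0] (mod int p)"
    then have "int p dvd s * v" by (simp add: cong_0_iff)
    then have "int p dvd 1" using v by (metis cong_dvd_iff)
    then show False using p(2) by simp
  qed
  then have "two_squares_count p s \<le> two_squares_count p (v * s)"
    by (rule two_squares_count_le_mult[OF p])
  also have "\<dots> = two_squares_count p 1"
    using v by (intro two_squares_count_cong) (simp add: mult.commute)
  finally show "two_squares_count p s \<le> two_squares_count p 1" .
qed

section \<open>Primes congruent to 3 modulo 4\<close>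

text \<open>Euler's criterion again: the exponent \<open>(p - 1) / 2\<close> is odd, so the power of \<open>-1\<close> is \<open>-1\<close>.\<close>

lemma minus_one_nonresidue:
  assumes "prime p" "[p = 3] (mod 4)"
  shows "\<not> QuadRes (int p) (-1)"
proof
  assume Q: "QuadRes (int p) (-1)"
  from assms(2) have p4: "p mod 4 = 3" by (simp add: cong_def)
  then have p2: "2 < p" by presburger
  have "odd ((p - 1) div 2)" using p4 by presburger
  then have "[Legendre (-1) (int p) = -1] (mod int p)"
    using euler_criterion[OF assms(1) p2, of "-1"] by simp
  moreover have "\<not> [0 = -1] (mod int p)" "\<not> [1 = -1] (mod int p)"
    using p2 zdvd_imp_le[of "int p" 2] by (auto simp: cong_iff_dvd_diff)
  ultimately show False using Q unfolding Legendre_def by (auto split: if_splits)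
qed

lemma sum_two_squares_cong_0:
  fixes x y :: int
  assumes p: "prime p" "[p = 3] (mod 4)" and xy: "[x\<^sup>2 + y\<^sup>2 = 0] (mod int p)"
  shows "int p dvd x \<and> int p dvd y"
proof -
  have pi: "prime (int p)" using p(1) by simp
  have y: "int p dvd y"
  proof (rule ccontr)
    assume "\<not> int p dvd y"
    then have "coprime y (int p)" using pi by (metis prime_imp_coprime coprime_commute)
    then obtain v where v: "[y * v = 1] (mod int p)" using cong_solve_coprime_int by blast
    have "[(x\<^sup>2 + y\<^sup>2) * v\<^sup>2 - (y * v)\<^sup>2 = 0 * v\<^sup>2 - 1\<^sup>2] (mod int p)"
      by (intro cong_diff cong_mult cong_pow xy v cong_refl)
    then have "[(x * v)\<^sup>2 = -1] (mod int p)" by (simp add: power2_eq_square algebra_simps)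
    then show False using minus_one_nonresidue[OF p] unfolding QuadRes_def by blast
  qed
  then have "int p dvd x\<^sup>2"
    using xy by (metis cong_0_iff dvd_add_left_iff dvd_power zero_less_numeral dvd_trans)
  then show ?thesis using y pi prime_dvd_power by blast
qed

lemma two_squares_count_0:
  assumes "prime p" "[p = 3] (mod 4)"
  shows "two_squares_count p 0 = 1"
proof -
  have "0 < p" using assms(1) by (rule prime_gt_0_nat)
  have "{(x, y) \<in> {0..<int p} \<times> {0..<int p}. [x\<^sup>2 + y\<^sup>2 = 0] (mod int p)} = {(0, 0)}"
  proof -
    have "x = 0 \<and> y = 0" if "x \<in> {0..<int p}" "y \<in> {0..<int p}" "[x\<^sup>2 + y\<^sup>2 = 0] (mod int p)" for x y
      using sum_two_squares_cong_0[OF assms that(3)] that(1,2) zdvd_not_zless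
      by (metis atLeastLessThan_iff le_less)
    then show ?thesis using \<open>0 < p\<close> by auto
  qed
  then show ?thesis by (simp add: two_squares_count_def)
qed

text \<open>
  Grouping pairs by the value of \<open>x\<^sup>2 + y\<^sup>2\<close> modulo \<open>p\<close>. It is applied to a constant \<open>h\<close>, to count all
  pairs, and to the count for the remaining variables, to obtain the recursion.
\<close>

lemma sum_over_two_squares:
  fixes h :: "int \<Rightarrow> nat"
  assumes "p > 0" and h: "\<And>s t. [s = t] (mod int p) \<Longrightarrow> h s = h t"
  shows "(\<Sum>(x, y)\<in>{0..<int p} \<times> {0..<int p}. h (x\<^sup>2 + y\<^sup>2))
    = (\<Sum>s\<in>{0..<int p}. two_squares_count p s * h s)"
proof -
  let ?C = "{0..<int p}"
  let ?g = "\<lambda>(x, y). (x\<^sup>2 + y\<^sup>2) mod int p"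
  have "(\<Sum>(x, y)\<in>?C \<times> ?C. h (x\<^sup>2 + y\<^sup>2)) = (\<Sum>z\<in>?C \<times> ?C. h (?g z))"
    by (intro sum.cong refl) (auto intro!: h simp: cong_def)
  also have "\<dots> = (\<Sum>s\<in>?C. card {z \<in> ?C \<times> ?C. ?g z = s} * h s)"
    using assms(1) by (subst sum_fun_comp[of _ ?C]) auto
  also have "\<dots> = (\<Sum>s\<in>?C. two_squares_count p s * h s)"
  proof (intro sum.cong refl)
    fix s assume "s \<in> ?C"
    then have "{z \<in> ?C \<times> ?C. ?g z = s} = {(x, y) \<in> ?C \<times> ?C. [x\<^sup>2 + y\<^sup>2 = s] (mod int p)}"
      by (auto simp: cong_def)
    then show "card {z \<in> ?C \<times> ?C. ?g z = s} * h s = two_squares_count p s * h s"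
      by (simp add: two_squares_count_def)
  qed
  finally show ?thesis .
qed

lemma two_squares_count_nonzero:
  assumes p: "prime p" "[p = 3] (mod 4)" and s: "\<not> [s = 0] (mod int p)"
  shows "two_squares_count p s = p + 1"
proof -
  have p2: "2 < p" 
    using p prime_ge_2_nat[of p] by (cases "p = 2") (auto simp: cong_def)
  have ne: "\<not> [u = 0] (mod int p)" if "u \<in> {0..<int p} - {0}" for u
    using that by (auto simp: cong_def)
  have "p * p = (\<Sum>u\<in>{0..<int p}. two_squares_count p u)"
    using sum_over_two_squares[of p "\<lambda>_. 1"] p2 by (simp add: case_prod_unfold)
  also have "\<dots> = two_squares_count p 0 + (\<Sum>u\<in>{0..<int p} - {0}. two_squares_count p u)"
    using p2 by (subst sum.remove[of _ 0]) auto
  also have "(\<Sum>u\<in>{0..<int p} - {0}. two_squares_count p u)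
      = (\<Sum>u\<in>{0..<int p} - {0}. two_squares_count p 1)"
    by (intro sum.cong refl two_squares_count_eq[OF p(1) p2] ne)
  also have "\<dots> = (p - 1) * two_squares_count p 1"
    using p2 by (simp add: card_Diff_singleton)
  finally have "p * p = 1 + (p - 1) * two_squares_count p 1"
    using two_squares_count_0[OF p] by simp
  moreover have "p * p = 1 + (p - 1) * (p + 1)"
    using p2 by (cases p) (auto simp: algebra_simps)
  ultimately have "(p - 1) * two_squares_count p 1 = (p - 1) * (p + 1)" by linarith
  then have "two_squares_count p 1 = p + 1"
    using p2 by (subst (asm) mult_left_cancel) simp_all
  then show ?thesis using two_squares_count_eq[OF p(1) p2 s] by simp
qed

section \<open>The recursion in the number of variables\<close>

text \<open>
  The squares of two new variables add up to each nonzero \<open>s\<close> in \<open>p + 1\<close> ways, and then the old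
  variables must represent \<open>t - s\<close>. If \<open>s = 0\<close> also had \<open>p + 1\<close> ways, the total would be \<open>p + 1\<close> times
  the number \<open>p\<^sup>j\<close> of all tuples of old variables; it has only one, and the second summand on the
  left makes up for the missing \<open>p\<close>.
\<close>

lemma squares_count_add_2:
  assumes p: "prime p" "[p = 3] (mod 4)"
  shows "squares_count p (j + 2) t + p * squares_count p j t = (p + 1) * p ^ j"
proof -
  let ?C = "{0..<int p}"
  let ?h = "\<lambda>s. squares_count p j (t - s)"
  have p0: "p > 0" using p(1) by (rule prime_gt_0_nat)
  have h: "?h s = ?h s'" if "[s = s'] (mod int p)" for s s'
    using that by (intro squares_count_cong cong_diff cong_refl)
  have ne: "\<not> [u = 0] (mod int p)" if "u \<in> ?C - {0}" for u
    using that by (auto simp: cong_def)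
  have "squares_count p (j + 2) t = (\<Sum>x\<in>?C. \<Sum>y\<in>?C. ?h (x\<^sup>2 + y\<^sup>2))"
    by (simp add: squares_count_Suc algebra_simps)
  also have "\<dots> = (\<Sum>(x, y)\<in>?C \<times> ?C. ?h (x\<^sup>2 + y\<^sup>2))"
    by (rule sum.cartesian_product)
  also have "\<dots> = (\<Sum>s\<in>?C. two_squares_count p s * ?h s)"
    by (rule sum_over_two_squares[OF p0]) (rule h)
  also have "\<dots> = squares_count p j t + (\<Sum>s\<in>?C - {0}. two_squares_count p s * ?h s)"
    using p0 two_squares_count_0[OF p] by (subst sum.remove[of _ 0]) auto
  also have "(\<Sum>s\<in>?C - {0}. two_squares_count p s * ?h s) = (\<Sum>s\<in>?C - {0}. (p + 1) * ?h s)"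
    using two_squares_count_nonzero[OF p] ne by (intro sum.cong) auto
  also have "squares_count p j t + (\<Sum>s\<in>?C - {0}. (p + 1) * ?h s) + p * squares_count p j t
      = (\<Sum>s\<in>?C. (p + 1) * ?h s)"
    using p0 by (subst sum.remove[of ?C 0]) auto
  also have "\<dots> = (p + 1) * p ^ j"
    using sum_squares_count[OF p0, of j t] by (simp only: sum_distrib_left[symmetric])
  finally show ?thesis .
qed

lemma squares_count_odd:
  assumes p: "prime p" "[p = 3] (mod 4)"
  shows "int (squares_count p (2 * m + 1) t)
    = int p ^ (2 * m) + (- int p) ^ m * (int (squares_count p 1 t) - 1)"
proof (induction m)
  case 0
  show ?case by simp
next
  case (Suc m)
  have "int (squares_count p (2 * m + 1 + 2) t)
      = (int p + 1) * int p ^ (2 * m + 1) - int p * int (squares_count p (2 * m + 1) t)"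
    using arg_cong[OF squares_count_add_2[OF p, of "2 * m + 1" t], of int]
    by (simp add: algebra_simps)
  also have "\<dots> = int p ^ (2 * Suc m) + (- int p) ^ Suc m * (int (squares_count p 1 t) - 1)"
    unfolding Suc.IH by (simp add: algebra_simps)
  finally show ?case by simp
qed

lemma squares_count_1_residue:
  assumes p: "prime p" "2 < p" and t: "\<not> [t = 0] (mod int p)" "QuadRes (int p) t"
  shows "squares_count p 1 t = 2"
proof -
  obtain z where z: "[z\<^sup>2 = t] (mod int p)" using t(2) unfolding QuadRes_def by auto
  define y where "y = z mod int p"
  have y: "[y\<^sup>2 = t] (mod int p)" using z by (simp add: y_def cong_def power_mod)
  have mem: "y \<in> {0..<int p}" using p by (simp add: y_def)
  have "y \<noteq> 0" using y t(1) by (auto simp: cong_sym_eq)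
  have "x \<in> {y, int p - y}" if x: "x \<in> {0..<int p}" "[x\<^sup>2 = t] (mod int p)" for x
  proof -
    have "[x\<^sup>2 = y\<^sup>2] (mod int p)" using x(2) y by (metis cong_sym cong_trans)
    then have "int p dvd (x - y) * (x + y)"
      by (simp add: cong_iff_dvd_diff power2_eq_square algebra_simps)
    then consider "int p dvd x - y" | "int p dvd x + y"
      using p(1) prime_dvd_mult_iff[of "int p"] by auto
    then show ?thesis
    proof cases
      case 1
      then have "[x = y] (mod int p)" by (simp add: cong_iff_dvd_diff)
      then show ?thesis using x(1) mem by (simp add: cong_def)
    next
      case 2
      then have "[x = int p - y] (mod int p)"
        using dvd_diff[of "int p" "x + y" "int p"] by (simp add: cong_iff_dvd_diff algebra_simps)
      then have "x = int p - y"
        using x(1) mem \<open>y \<noteq> 0\<close> by (intro cong_less_imp_eq_int[of x "int p"]) auto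
      then show ?thesis by simp
    qed
  qed
  moreover have "[(int p - y)\<^sup>2 = t] (mod int p)"
  proof -
    have "[(int p - y)\<^sup>2 = (- y)\<^sup>2] (mod int p)"
      by (rule cong_pow) (simp add: cong_iff_dvd_diff)
    then show ?thesis using y by (simp) (metis cong_trans)
  qed
  ultimately have "{x \<in> {0..<int p}. [x\<^sup>2 = t] (mod int p)} = {y, int p - y}"
    using y mem \<open>y \<noteq> 0\<close> by auto
  moreover have "y \<noteq> int p - y"
  proof
    assume "y = int p - y"
    then have "int p = 2 * y" by simp
    then have "even p" by (metis even_of_nat dvd_triv_left)
    then show False using p prime_odd_nat by blast
  qed
  ultimately show ?thesis by (simp only: squares_count_1 card_2_iff) blast
qed

lemma squares_count_1_nonresidue:
  assumes "\<not> QuadRes (int p) t"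
  shows "squares_count p 1 t = 0"
  using assms unfolding squares_count_1 QuadRes_def by auto

lemma squares_count_1_0:
  assumes "prime p"
  shows "squares_count p 1 0 = 1"
proof -
  have "x = 0" if "x \<in> {0..<int p}" "[x\<^sup>2 = 0] (mod int p)" for x
  proof -
    have "int p dvd x" using that(2) assms by (metis cong_0_iff prime_dvd_power prime_nat_int_transfer)
    then show ?thesis using that(1) zdvd_not_zless by (metis atLeastLessThan_iff le_less)
  qed
  then have "{x \<in> {0..<int p}. [x\<^sup>2 = 0] (mod int p)} = {0}"
    using prime_gt_0_nat[OF assms] by auto
  then show ?thesis unfolding squares_count_1 by simp
qed

theorem theorem1p7:
  fixes p m :: nat and t :: int
  assumes "prime p" and "odd p" and "[p = 3] (mod 4)"
    and "t \<in> carrier (residue_ring (int p))"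
  shows "(t = \<zero>\<^bsub>residue_ring (int p)\<^esub> \<longrightarrow>
            int (num_sum_squares (2 * m + 1) t p) = int p ^ (2 * m)) \<and>
         (is_nonresidue p t \<longrightarrow>
            int (num_sum_squares (2 * m + 1) t p) = int p ^ (2 * m) + (- 1) ^ (m + 1) * int p ^ m) \<and>
         (is_residue p t \<longrightarrow>
            int (num_sum_squares (2 * m + 1) t p) = int p ^ (2 * m) + (- 1) ^ m * int p ^ m)"
proof -
  have p2: "2 < p"
    using assms(1,2) prime_ge_2_nat[of p] by (cases "p = 2") auto
  then interpret residues "int p" "residue_ring (int p)"
    by unfold_locales auto
  have t: "t \<in> {0..<int p}" using assms(4) by (auto simp: res_carrier_eq)
  have sq: "is_square_mod p t \<longleftrightarrow> QuadRes (int p) t"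
    using p2 t by (intro is_square_mod_iff_QuadRes) auto
  have count: "int (num_sum_squares (2 * m + 1) t p)
      = int p ^ (2 * m) + (- int p) ^ m * (int (squares_count p 1 t) - 1)"
    using num_sum_squares_eq_squares_count[of p t] p2 t squares_count_odd[OF assms(1,3)] by simp
  have sign: "(- int p) ^ m = (- 1) ^ m * int p ^ m"
    by (rule power_minus)
  have nz: "\<not> [t = 0] (mod int p)" if "t \<noteq> 0"
    using that t by (simp add: cong_def)
  show ?thesis
  proof (intro conjI impI)
    assume "t = \<zero>\<^bsub>residue_ring (int p)\<^esub>"
    then show "int (num_sum_squares (2 * m + 1) t p) = int p ^ (2 * m)"
      unfolding count using squares_count_1_0[OF assms(1)] by (simp add: res_zero_eq)
  next
    assume "is_nonresidue p t"
    then have "squares_count p 1 t = 0"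
      using sq squares_count_1_nonresidue by (simp add: is_nonresidue_def)
    then show "int (num_sum_squares (2 * m + 1) t p) = int p ^ (2 * m) + (- 1) ^ (m + 1) * int p ^ m"
      unfolding count sign by simp
  next
    assume "is_residue p t"
    then have "squares_count p 1 t = 2"
      using sq nz squares_count_1_residue[OF assms(1) p2] by (simp add: is_residue_def res_zero_eq)
    then show "int (num_sum_squares (2 * m + 1) t p) = int p ^ (2 * m) + (- 1) ^ m * int p ^ m"
      unfolding count sign by simp
  qed
qed

end
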